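(* For every Korselt number ($KN$) $n$, $$n\le \tfrac12\left(P^6+2P^5-P^4-P^3+2P^2-P\right),$$ with equality if and only if $q=P^2+P-1$ and $r=\frac12(P-1)(P+1)^2+1$.
   Context: A Korselt number ($KN$) is an integer $n$ together with a factorisation $n=\prod_{i=1}^d p_i$, where $d\ge 3$ and $1<p_1<p_2<\dots<p_d$ are odd integers (not necessarily prime), such that $p_i-1$ divides $n-1$ for every $i$, and such that $E:=\dfrac{n/p_d-1}{p_d-1}$ (which is an integer by the divisibility condition) satisfies $E\ge 2$. Notation: $P:=\prod_{i=1}^{d-2}p_i$, $q:=p_{d-1}$, $r:=p_d$, so that $n=Pqr$. *)

theory Defs
  imports Complex_Main
begin

text \<open>
  Being a Korselt number is a property of an integer together with a chosen
  factorisation into odd, not necessarily prime, factors \<open>p 1 < \<dots> < p d\<close>.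
  Only the values of \<open>p\<close> on \<open>{1..d}\<close> matter.
\<close>

definition korselt_E :: "nat \<Rightarrow> (nat \<Rightarrow> int) \<Rightarrow> int \<Rightarrow> real" where
  "korselt_E d p n = (real_of_int n / real_of_int (p d) - 1) / (real_of_int (p d) - 1)"

definition korselt_number :: "nat \<Rightarrow> (nat \<Rightarrow> int) \<Rightarrow> int \<Rightarrow> bool" where
  "korselt_number d p n \<longleftrightarrow>
     d \<ge> 3 \<and>
     n = (\<Prod>i=1..d. p i) \<and>
     (\<forall>i\<in>{1..d}. 1 < p i \<and> odd (p i)) \<and>
     strict_mono_on {1..d} p \<and>
     (\<forall>i\<in>{1..d}. (p i - 1) dvd (n - 1)) \<and>
     korselt_E d p n \<ge> 2"

end

theory Submission
  imports Defs
begin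

text \<open>
  Put \<open>E = (P q - 1)/(r - 1)\<close> and \<open>D = (P r - 1)/(q - 1)\<close>. Eliminating \<open>r\<close> gives
  \<open>(q - 1) (D E - P\<^sup>2) = (P - 1) (P + E)\<close>, hence \<open>q - 1 \<le> (P - 1) (P + E)\<close>,
  and \<open>E n = P q (P q - 1 + E)\<close> is increasing in \<open>q\<close>. With \<open>q\<close> maximal, \<open>n\<close> becomes
  a convex function of \<open>E\<close>, and on \<open>2 \<le> E < P\<close> it is largest at \<open>E = 2\<close> only.
\<close>

text \<open>The right side of the eliminated identity is positive, so the cofactor
  \<open>D * E - P\<^sup>2\<close> of \<open>q - 1\<close> is a positive integer, hence at least
  1.\<close>

lemma korselt_q_bound:
  fixes P q r D E :: int
  assumes "1 < P" "1 < q" "0 < E"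
    and E: "P * q - 1 = E * (r - 1)" and D: "P * r - 1 = D * (q - 1)"
  shows "q \<le> 1 + (P - 1) * (P + E)"
proof -
  \<comment> \<open>After multiplication by \<open>E\<close>, the unknown \<open>r\<close> occurs
    only in \<open>E * (r - 1)\<close>, which \<open>E\<close> replaces by
    \<open>P * q - 1\<close>.\<close>
  have "E * (P * r - 1) = P * (E * (r - 1)) + E * (P - 1)"
    by (simp add: algebra_simps)
  then have "E * (D * (q - 1)) = P * (P * q - 1) + E * (P - 1)"
    by (simp only: E D)
  then have eq: "(q - 1) * (D * E - P\<^sup>2) = (P - 1) * (P + E)"
    by (simp add: algebra_simps power2_eq_square)
  have pos: "0 < (P - 1) * (P + E)"
    using assms by simp
  with eq have "0 < D * E - P\<^sup>2"
    using \<open>1 < q\<close> by (metis diff_gt_0_iff_gt zero_less_mult_pos)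
  then have "(q - 1) * 1 \<le> (q - 1) * (D * E - P\<^sup>2)"
    using \<open>1 < q\<close> by (intro mult_left_mono) auto
  with eq show ?thesis by simp
qed

lemma korselt_less_if_E_gt_2:
  fixes P E :: int
  assumes "2 < E" "E < P" and Q: "Q = 1 + (P - 1) * (P + E)"
  shows "2 * (P * Q * (P * Q - 1 + E))
    < E * (P ^ 6 + 2 * P ^ 5 - P ^ 4 - P ^ 3 + 2 * P ^ 2 - P)"
proof -
  \<comment> \<open>These make \<open>P * Q = (a + 1) + b * E\<close> and
    \<open>P * Q - 1 + E = a + (b + 1) * E\<close>. Their product divided by \<open>E\<close> is a
    constant plus \<open>a * (a + 1) / E + b * (b + 1) * E\<close>, so comparing it with its value
    at \<open>E = 2\<close> splits off the factor \<open>E - 2\<close>.\<close>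
  define a where "a = (P - 1) * (P\<^sup>2 + 1)"
  define b where "b = P * (P - 1)"
  \<comment> \<open>Both sides contain \<open>P - 1\<close>. Without it, the claim follows factor by
    factor from \<open>2 * P * E < a + 1\<close> and
    \<open>b + 1 \<le> P\<^sup>2 + 1\<close>.\<close>
  have "2 * E * (b * (b + 1)) < a * (a + 1)"
  proof -
    have "2 * P \<le> P\<^sup>2 + 1"
      using zero_le_power2[of "P - 1"] by (simp add: power2_eq_square algebra_simps)
    then have "(P - 1) * (2 * P) \<le> a"
      unfolding a_def using assms by (intro mult_left_mono) auto
    moreover have "2 * P * E \<le> 2 * P * (P - 1)"
      using assms by (intro mult_left_mono) auto
    ultimately have "2 * P * E < a + 1"
      by (simp add: algebra_simps)
    moreover have "b + 1 \<le> P\<^sup>2 + 1"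
      using assms by (simp add: b_def power2_eq_square right_diff_distrib)
    moreover have "0 < b + 1"
      using assms by (simp add: b_def add_pos_pos)
    ultimately have "(2 * P * E) * (b + 1) < (a + 1) * (P\<^sup>2 + 1)"
      using assms by (intro mult_less_le_imp_less) auto
    then have "(P - 1) * ((2 * P * E) * (b + 1)) < (P - 1) * ((a + 1) * (P\<^sup>2 + 1))"
      using assms by (intro mult_strict_left_mono) auto
    then show ?thesis
      unfolding b_def a_def by (simp add: mult_ac)
  qed
  then have "0 < (E - 2) * (a * (a + 1) - 2 * E * (b * (b + 1)))"
    using assms by simp
  also have "\<dots> = E * (P ^ 6 + 2 * P ^ 5 - P ^ 4 - P ^ 3 + 2 * P ^ 2 - P)
      - 2 * (P * Q * (P * Q - 1 + E))"
    unfolding a_def b_def Q by algebra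
  finally show ?thesis by simp
qed

text \<open>The whole argument over the integers: the condition on \<open>E\<close> and the formula
  for \<open>r\<close> are cleared of denominators.\<close>

lemma korselt_bound_int:
  fixes P q r :: int
  assumes "1 < q" "q < r"
    and dvd: "(q - 1) dvd (P * q * r - 1)" "(r - 1) dvd (P * q * r - 1)"
    and E_ge: "2 * (r - 1) \<le> P * q - 1"
  defines "B \<equiv> P ^ 6 + 2 * P ^ 5 - P ^ 4 - P ^ 3 + 2 * P ^ 2 - P"
  shows "2 * (P * q * r) \<le> B"
    and "2 * (P * q * r) = B \<longleftrightarrow> q = P\<^sup>2 + P - 1 \<and> 2 * (r - 1) = (P - 1) * (P + 1)\<^sup>2"
proof -
  have "(r - 1) dvd (P * q * r - 1) - (r - 1) * (P * q)"
    by (rule dvd_diff[OF dvd(2) dvd_triv_left])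
  then have "(r - 1) dvd (P * q - 1)"
    by (simp add: algebra_simps)
  then obtain E where E: "P * q - 1 = E * (r - 1)"
    by (metis dvdE mult.commute)
  have "(q - 1) dvd (P * q * r - 1) - (q - 1) * (P * r)"
    by (rule dvd_diff[OF dvd(1) dvd_triv_left])
  then have "(q - 1) dvd (P * r - 1)"
    by (simp add: algebra_simps)
  then obtain D where D: "P * r - 1 = D * (q - 1)"
    by (metis dvdE mult.commute)
  have E2: "2 \<le> E"
    using E_ge E assms(1,2) by (intro mult_right_le_imp_le[of 2 "r - 1" E]) auto
  \<comment> \<open>Integrality turns \<open>q < r\<close> into \<open>q \<le> r - 1\<close>. The
    resulting \<open>2 \<le> E < P\<close> also supplies the positivity of \<open>P\<close>.\<close>
  have "E * q \<le> E * (r - 1)"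
    using E2 assms(2) by (intro mult_left_mono) auto
  also have "\<dots> < P * q" using E by simp
  finally have EP: "E < P"
    using assms(1) by simp
  define Q where "Q = 1 + (P - 1) * (P + E)"
  have qQ: "q \<le> Q"
    unfolding Q_def using korselt_q_bound[OF _ _ _ E D] E2 EP assms(1) by simp
  have "E * (P * q * r) = P * q * (E * (r - 1) + E)"
    by (simp add: algebra_simps)
  then have En: "E * (P * q * r) = P * q * (P * q - 1 + E)"
    by (simp only: E)
  \<comment> \<open>Strictness is what makes \<open>q = Q\<close> the only candidate for equality
    when \<open>E = 2\<close>.\<close>
  have strict: "P * q * (P * q - 1 + E) < P * Q * (P * Q - 1 + E)" if "q < Q"
  proof (rule mult_strict_mono)
    show "P * q < P * Q" using that EP E2 by simp
    then show "P * q - 1 + E < P * Q - 1 + E" by simp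
    have "0 < P * q" using EP E2 assms(1) by simp
    then show "0 < P * Q" "0 \<le> P * q - 1 + E"
      using \<open>P * q < P * Q\<close> E2 by linarith+
  qed
  have "2 * (P * q * r) \<le> B \<and>
    (2 * (P * q * r) = B \<longleftrightarrow> q = P\<^sup>2 + P - 1 \<and> 2 * (r - 1) = (P - 1) * (P + 1)\<^sup>2)"
  proof (cases "E = 2")
    case True
    have Q: "Q = P\<^sup>2 + P - 1"
      unfolding Q_def True by algebra
    have B: "P * Q * (P * Q - 1 + E) = B"
      unfolding Q True B_def by algebra
    \<comment> \<open>For \<open>E = 2\<close> the value of \<open>q\<close> determines
      \<open>r\<close>, so the second equality condition is automatic.\<close>
    have "2 * (r - 1) = (P - 1) * (P + 1)\<^sup>2" if "q = P\<^sup>2 + P - 1"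
    proof -
      have "2 * (r - 1) = P * q - 1" using E True by simp
      also have "\<dots> = (P - 1) * (P + 1)\<^sup>2" unfolding that by algebra
      finally show ?thesis .
    qed
    moreover have "2 * (P * q * r) < B" if "q < Q"
      using strict[OF that] En B unfolding True by linarith
    moreover have "2 * (P * q * r) = B" if "q = Q"
      using En B unfolding True that by linarith
    ultimately show ?thesis
      using qQ Q by (metis less_irrefl order_le_less)
  next
    case False
    then have "2 * (P * Q * (P * Q - 1 + E)) < E * B"
      unfolding B_def using E2 EP by (intro korselt_less_if_E_gt_2[OF _ _ Q_def]) auto
    moreover have "P * q * (P * q - 1 + E) \<le> P * Q * (P * Q - 1 + E)"
      using strict qQ by (cases "q = Q") auto
    moreover have "E * (2 * (P * q * r)) = 2 * (P * q * (P * q - 1 + E))"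
      using En by (simp only: mult.left_commute[of E 2])
    ultimately have "E * (2 * (P * q * r)) < E * B"
      by linarith
    then have less: "2 * (P * q * r) < B"
      using E2 by simp
    \<comment> \<open>The bound is strict here, so the two formulas must not hold together: they
      would force \<open>2 * (P * q * r) = B\<close>.\<close>
    have "2 * (r - 1) \<noteq> (P - 1) * (P + 1)\<^sup>2" if q: "q = P\<^sup>2 + P - 1"
    proof
      assume "2 * (r - 1) = (P - 1) * (P + 1)\<^sup>2"
      then have "2 * r = (P - 1) * (P + 1)\<^sup>2 + 2" by simp
      then have "P * q * (2 * r) = B"
        unfolding q B_def by algebra
      with less show False by (simp add: mult_ac)
    qed
    with less show ?thesis by auto
  qed
  then show "2 * (P * q * r) \<le> B"
    and "2 * (P * q * r) = B \<longleftrightarrow> q = P\<^sup>2 + P - 1 \<and> 2 * (r - 1) = (P - 1) * (P + 1)\<^sup>2"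
    by blast+
qed

theorem theorem3p3:
  fixes d :: nat and p :: "nat \<Rightarrow> int" and n P q r :: int
  assumes "korselt_number d p n"
    and "P = (\<Prod>i=1..d-2. p i)" and "q = p (d - 1)" and "r = p d"
  shows "real_of_int n \<le> 1/2 * (real_of_int P ^ 6 + 2 * real_of_int P ^ 5 - real_of_int P ^ 4
           - real_of_int P ^ 3 + 2 * real_of_int P ^ 2 - real_of_int P) \<and>
         (real_of_int n = 1/2 * (real_of_int P ^ 6 + 2 * real_of_int P ^ 5 - real_of_int P ^ 4
           - real_of_int P ^ 3 + 2 * real_of_int P ^ 2 - real_of_int P)
         \<longleftrightarrow> q = P ^ 2 + P - 1 \<and>
             real_of_int r = 1/2 * (real_of_int P - 1) * (real_of_int P + 1) ^ 2 + 1)"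
proof -
  note K = assms(1)[unfolded korselt_number_def]
  have d: "3 \<le> d" and p_gt: "\<And>i. i \<in> {1..d} \<Longrightarrow> 1 < p i"
    using K by auto
  \<comment> \<open>Two visible successors let the product over \<open>{1..d}\<close> split into
    \<open>P\<close>, \<open>q\<close> and \<open>r\<close>.\<close>
  obtain k where k: "d = Suc (Suc k)"
    using d by (metis Suc_le_D numeral_3_eq_3 Suc_le_mono)
  have n: "n = P * q * r"
    using K unfolding assms(2-4) k by (simp add: prod.atLeast1_atMost_eq)
  have q: "1 < q"
    using p_gt d unfolding assms(3) by simp
  have qr: "q < r"
    using K d unfolding assms(3,4) by (auto intro: strict_mono_onD)
  have dvd: "(q - 1) dvd (P * q * r - 1)" "(r - 1) dvd (P * q * r - 1)"
  proof -
    have "\<forall>i\<in>{1..d}. (p i - 1) dvd (n - 1)" using K by blast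
    then show "(q - 1) dvd (P * q * r - 1)" "(r - 1) dvd (P * q * r - 1)"
      using d unfolding n[symmetric] unfolding assms(3,4) by simp_all
  qed
  have "2 \<le> (real_of_int (P * q) - 1) / (real_of_int r - 1)"
    using K q qr unfolding korselt_E_def n assms(4)[symmetric] by simp
  then have "real_of_int (2 * (r - 1)) \<le> real_of_int (P * q - 1)"
    using q qr by (simp add: field_simps)
  then have E_ge: "2 * (r - 1) \<le> P * q - 1"
    by (simp only: of_int_le_iff)
  note bound = korselt_bound_int[OF q qr dvd E_ge, folded n]
  let ?B = "P ^ 6 + 2 * P ^ 5 - P ^ 4 - P ^ 3 + 2 * P ^ 2 - P"
  have B: "1/2 * (real_of_int P ^ 6 + 2 * real_of_int P ^ 5 - real_of_int P ^ 4
      - real_of_int P ^ 3 + 2 * real_of_int P ^ 2 - real_of_int P) = real_of_int ?B / 2"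
    by simp
  have half: "real_of_int n \<le> real_of_int m / 2 \<longleftrightarrow> 2 * n \<le> m"
    "real_of_int n = real_of_int m / 2 \<longleftrightarrow> 2 * n = m" for m
    by linarith+
  have r: "real_of_int r = 1/2 * (real_of_int P - 1) * (real_of_int P + 1) ^ 2 + 1
      \<longleftrightarrow> 2 * (r - 1) = (P - 1) * (P + 1)\<^sup>2"
  proof -
    have "1/2 * (real_of_int P - 1) * (real_of_int P + 1) ^ 2 + 1
        = real_of_int ((P - 1) * (P + 1)\<^sup>2) / 2 + 1"
      by simp
    moreover have "real_of_int r = real_of_int m / 2 + 1 \<longleftrightarrow> 2 * (r - 1) = m" for m
      unfolding right_diff_distrib by linarith
    ultimately show ?thesis by (simp only:)
  qed
  show ?thesis
    unfolding B half r using bound by blast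
qed

end
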